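(* Let $\mathbf{X}\in\mathbb{R}^{a\times b}$, $\mathbf{W}\in\mathbb{R}^{b\times c}$, and let $\mathbf{Y}=\mathbf{0}\in\mathbb{R}^{c\times d}$. Then for all $j\in\{1,\dots,b\}$ and $k\in\{1,\dots,c\}$ the pruning score $\mathbf{S}_{jk}$ (defined in the context) equals $$\mathbf{S}_{jk}=|\mathbf{W}_{jk}|\,\|\mathbf{X}_{:j}\|_2 .$$
   Context: For $\mathbf{X}\in\mathbb{R}^{a\times b}$, $\mathbf{W}\in\mathbb{R}^{b\times c}$, $\mathbf{Y}\in\mathbb{R}^{c\times d}$ and $\widetilde{\mathbf{W}}\in\mathbb{R}^{b\times c}$, put $g(\widetilde{\mathbf{W}}):=\|\mathbf{X}(\widetilde{\mathbf{W}}-\mathbf{W})\|_F+\|(\widetilde{\mathbf{W}}-\mathbf{W})\mathbf{Y}\|_F$, where $\|\cdot\|_F$ is the Frobenius norm. The pruning score $\mathbf{S}_{jk}$ is the value $g(\widetilde{\mathbf{W}})$ at the matrix $\widetilde{\mathbf{W}}$ obtained from $\mathbf{W}$ by setting the entry $(j,k)$ to $0$ and keeping all other entries unchanged. $\mathbf{M}_{:j}$ denotes the $j$-th column of a matrix $\mathbf{M}$; $\|\cdot\|_2$ is the Euclidean norm. *)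

theory Defs
  imports "HOL-Analysis.Analysis"
begin

text \<open>A matrix with \<open>m\<close> rows and \<open>n\<close> columns is an element of \<open>real ^ 'n ^ 'm\<close>:
  the row index type is the outer one.\<close>

definition frobenius_norm :: "real ^ 'n ^ 'm \<Rightarrow> real" where
  "frobenius_norm A = sqrt (\<Sum>i\<in>UNIV. \<Sum>j\<in>UNIV. (A $ i $ j)\<^sup>2)"

definition pruning_objective ::
    "real ^ 'b ^ 'a \<Rightarrow> real ^ 'c ^ 'b \<Rightarrow> real ^ 'd ^ 'c \<Rightarrow> real ^ 'c ^ 'b \<Rightarrow> real" where
  "pruning_objective X W Y W' =
     frobenius_norm (X ** (W' - W)) + frobenius_norm ((W' - W) ** Y)"

definition prune_entry :: "real ^ 'c ^ 'b \<Rightarrow> 'b \<Rightarrow> 'c \<Rightarrow> real ^ 'c ^ 'b" where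
  "prune_entry W j k = (\<chi> p q. if p = j \<and> q = k then 0 else W $ p $ q)"

definition pruning_score ::
    "real ^ 'b ^ 'a \<Rightarrow> real ^ 'c ^ 'b \<Rightarrow> real ^ 'd ^ 'c \<Rightarrow> 'b \<Rightarrow> 'c \<Rightarrow> real" where
  "pruning_score X W Y j k = pruning_objective X W Y (prune_entry W j k)"

end

theory Submission
  imports Defs
begin

text \<open>Zeroing entry (j,k) changes \<open>W\<close> by -W_jk e_j e_k^T, so multiplying by
  \<open>X\<close> on the left gives a matrix whose only possibly nonzero column is the k-th, namely
  -W_jk times column j of \<open>X\<close> (\<open>matrix_mult_prune_entry_diff\<close>). The
  Frobenius norm of such a matrix is the Euclidean norm of that column
  (\<open>frobenius_norm_single_column\<close>), and the term with \<open>Y\<close>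
  vanishes.\<close>

lemma frobenius_norm_zero [simp]: "frobenius_norm 0 = 0"
  by (simp add: frobenius_norm_def)

lemma matrix_mult_prune_entry_diff:
  fixes X :: "real ^ 'b ^ 'a" and W :: "real ^ 'c ^ 'b"
  shows "(X ** (prune_entry W j k - W)) $ i $ l = (if l = k then - (X $ i $ j * W $ j $ k) else 0)"
proof -
  have "(X ** (prune_entry W j k - W)) $ i $ l =
      (\<Sum>p\<in>UNIV. if p = j then (if l = k then - (X $ i $ j * W $ j $ k) else 0) else 0)"
    unfolding matrix_matrix_mult_def vec_lambda_beta
    by (rule sum.cong) (auto simp: prune_entry_def)
  then show ?thesis
    by simp
qed

text \<open>Each row contributes a single square, so the double sum reduces to the sum of squares
  along column k.\<close>

lemma frobenius_norm_single_column:
  fixes A :: "real ^ 'n ^ 'm"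
  assumes "\<And>i l. l \<noteq> k \<Longrightarrow> A $ i $ l = 0"
  shows "frobenius_norm A = norm (column k A)"
proof -
  have "(\<Sum>l\<in>UNIV. (A $ i $ l)\<^sup>2) = (A $ i $ k)\<^sup>2" for i
  proof -
    have "(\<Sum>l\<in>UNIV. (A $ i $ l)\<^sup>2) = (\<Sum>l\<in>UNIV. if l = k then (A $ i $ k)\<^sup>2 else 0)"
      using assms by (intro sum.cong) auto
    then show ?thesis
      by simp
  qed
  then show ?thesis
    by (simp add: frobenius_norm_def norm_vec_def L2_set_def column_def)
qed

theorem corollary3p2:
  fixes X :: "real ^ 'b ^ 'a"
    and W :: "real ^ 'c ^ 'b"
    and Y :: "real ^ 'd ^ 'c"
  assumes "Y = 0"
  shows "\<forall>j k. pruning_score X W Y j k = \<bar>W $ j $ k\<bar> * norm (column j X)"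
proof (intro allI)
  fix j k
  let ?A = "X ** (prune_entry W j k - W)"
  have "(prune_entry W j k - W) ** Y = 0"
    using assms by (simp add: matrix_matrix_mult_def vec_eq_iff)
  then have "pruning_score X W Y j k = frobenius_norm ?A"
    by (simp add: pruning_score_def pruning_objective_def)
  also have "\<dots> = norm (column k ?A)"
    by (rule frobenius_norm_single_column) (simp add: matrix_mult_prune_entry_diff)
  \<comment> \<open>In this form homogeneity of the norm pulls out the scalar, and its absolute
    value absorbs the sign.\<close>
  also have "column k ?A = (- (W $ j $ k)) *\<^sub>R column j X"
    by (simp add: column_def vec_eq_iff matrix_mult_prune_entry_diff)
  finally show "pruning_score X W Y j k = \<bar>W $ j $ k\<bar> * norm (column j X)"
    by simp
qed

end
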